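(* Let $0<p\le q$ and $n=p+q$. Let $\alpha\in\mathbb{R}$, $k\in\{1,2\}$, and let $N$ be an endomorphism of $\mathbb{C}^n$ with $N^2=0$, $N^*=-N$, $\operatorname{rank}N=1$. Then the nilpotent loop $m_{\alpha,k,N}(\lambda)=\mathrm{I}+\left(\frac{1}{\lambda-\alpha}\right)^kN$ can be factored as a product of finitely many loops of the form $$g_{\mu,\nu,L,K,W}(\lambda)=\left(\frac{\lambda-\mu}{\lambda-\nu}\right)\pi_L+\left(\frac{\lambda-\bar\nu}{\lambda-\bar\mu}\right)\pi_K+\pi_W,$$ where (possibly different for each factor) $\mu,\nu\in\mathbb{C}$, $L,K\subset\mathbb{C}^n$ are isotropic complex lines with $\langle L,K\rangle\ne0$, and $W=L^\perp\cap K^\perp$.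
   Context: On $\mathbb{C}^n$, $n=p+q$, let $\langle v,w\rangle=-\sum_{i=1}^p\overline{v_i}w_i+\sum_{i=p+1}^{p+q}\overline{v_i}w_i$. The symbol $\perp$ refers to orthogonality with respect to $\langle\cdot,\cdot\rangle$; a subspace is isotropic if $\langle\cdot,\cdot\rangle$ vanishes identically on it. For lines $L,K$, $\langle L,K\rangle\ne0$ means $\langle v,w\rangle\neq0$ for nonzero $v\in L,w\in K$. Put $s=\mathrm{diag}(-\mathrm{I}_p,\mathrm{I}_q)$; $A^*=s\bar A^t s$ is the adjoint with respect to $\langle\cdot,\cdot\rangle$. The projections $\pi_L,\pi_K,\pi_W$ are those of the decomposition $\mathbb{C}^n=L\oplus K\oplus W$, each onto the named summand along the sum of the other two. *)

theory Defs
  imports "HOL-Analysis.Analysis"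
begin

text \<open>
  \<open>\<complex>\<^sup>n\<close> with \<open>n = p + q\<close> is \<open>complex ^ ('p + 'q)\<close> with \<open>p = CARD('p)\<close>, \<open>q = CARD('q)\<close>:
  the indices \<open>Inl _\<close> are the first \<open>p\<close> coordinates and \<open>Inr _\<close> the last \<open>q\<close>.
  Endomorphisms of \<open>\<complex>\<^sup>n\<close> are identified with their matrices. Since the \<open>real_vector\<close> notions
  \<open>subspace\<close> and \<open>dim\<close> on this type are over \<open>\<real>\<close>, complex linear algebra
  goes through \<open>vec.subspace\<close> and \<open>vec.dim\<close>.
\<close>

definition herm :: "complex ^ ('p::finite + 'q::finite) \<Rightarrow> complex ^ ('p + 'q) \<Rightarrow> complex" where
  "herm v w = - (\<Sum>i\<in>UNIV. cnj (v $ Inl i) * w $ Inl i) + (\<Sum>j\<in>UNIV. cnj (v $ Inr j) * w $ Inr j)"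

definition sig :: "complex ^ ('p::finite + 'q::finite) ^ ('p + 'q)" where
  "sig = (\<chi> i j. if i = j then (case i of Inl _ \<Rightarrow> - 1 | Inr _ \<Rightarrow> 1) else 0)"

definition adj :: "complex ^ ('p::finite + 'q::finite) ^ ('p + 'q) \<Rightarrow> complex ^ ('p + 'q) ^ ('p + 'q)" where
  "adj A = sig ** transpose (map_matrix cnj A) ** sig"

definition perp :: "(complex ^ ('p::finite + 'q::finite)) set \<Rightarrow> (complex ^ ('p + 'q)) set" where
  "perp S = {w. \<forall>v\<in>S. herm v w = 0}"

definition isotropic :: "(complex ^ ('p::finite + 'q::finite)) set \<Rightarrow> bool" where
  "isotropic S \<longleftrightarrow> (\<forall>v\<in>S. \<forall>w\<in>S. herm v w = 0)"

definition complex_line :: "(complex ^ 'n::finite) set \<Rightarrow> bool" where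
  "complex_line L \<longleftrightarrow> vec.subspace L \<and> vec.dim L = 1"

definition lines_nonorthogonal ::
  "(complex ^ ('p::finite + 'q::finite)) set \<Rightarrow> (complex ^ ('p + 'q)) set \<Rightarrow> bool" where
  "lines_nonorthogonal L K \<longleftrightarrow> (\<forall>v\<in>L. \<forall>w\<in>K. v \<noteq> 0 \<longrightarrow> w \<noteq> 0 \<longrightarrow> herm v w \<noteq> 0)"

text \<open>The projection onto \<open>A\<close> along \<open>B + C\<close>; meaningful only if the ambient space is the direct sum
  of the subspaces \<open>A\<close>, \<open>B\<close>, \<open>C\<close>.\<close>

definition proj3 ::
  "(complex ^ 'n::finite) set \<Rightarrow> (complex ^ 'n) set \<Rightarrow> (complex ^ 'n) set \<Rightarrow> complex ^ 'n ^ 'n" where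
  "proj3 A B C = matrix (\<lambda>x. THE a. a \<in> A \<and> (\<exists>b\<in>B. \<exists>c\<in>C. x = a + b + c))"

definition factor_data ::
  "(complex ^ ('p::finite + 'q::finite)) set \<Rightarrow> (complex ^ ('p + 'q)) set \<Rightarrow>
    (complex ^ ('p + 'q)) set \<Rightarrow> bool" where
  "factor_data L K W \<longleftrightarrow>
     complex_line L \<and> isotropic L \<and> complex_line K \<and> isotropic K \<and>
     lines_nonorthogonal L K \<and> W = perp L \<inter> perp K"

definition simple_loop ::
  "complex \<Rightarrow> complex \<Rightarrow> (complex ^ 'n::finite) set \<Rightarrow> (complex ^ 'n) set \<Rightarrow> (complex ^ 'n) set \<Rightarrow>
    complex \<Rightarrow> complex ^ 'n ^ 'n" where
  "simple_loop \<mu> \<nu> L K W z =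
     map_matrix ((*) ((z - \<mu>) / (z - \<nu>))) (proj3 L K W) +
     map_matrix ((*) ((z - cnj \<nu>) / (z - cnj \<mu>))) (proj3 K L W) +
     proj3 W L K"

definition nilpotent_loop ::
  "real \<Rightarrow> nat \<Rightarrow> complex ^ 'n::finite ^ 'n \<Rightarrow> complex \<Rightarrow> complex ^ 'n ^ 'n" where
  "nilpotent_loop \<alpha> k N z = mat 1 + map_matrix ((*) ((1 / (z - complex_of_real \<alpha>)) ^ k)) N"

text \<open>The pointwise product of loops, in the order of the list.\<close>

definition loop_prod :: "(complex \<Rightarrow> complex ^ 'n::finite ^ 'n) list \<Rightarrow> complex \<Rightarrow> complex ^ 'n ^ 'n" where
  "loop_prod gs z = foldr (\<lambda>g A. g z ** A) gs (mat 1)"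

end

theory Submission
  imports Defs
begin

text \<open>
  Write \<open>N x = \<kappa> \<langle>v, x\<rangle> v\<close> with \<open>v\<close> isotropic and \<open>\<kappa>\<close> imaginary, and put \<open>w = s v\<close>, which is isotropic
  with \<open>\<langle>v, w\<rangle> \<noteq> 0\<close>. For real \<open>t\<close> the isometry \<open>U = I + t N\<close> fixes \<open>v\<close> and moves \<open>w\<close> to another
  isotropic vector. For \<open>f = (\<lambda> - \<mu>) / (\<lambda> - \<alpha>)\<close> with \<open>\<mu>\<close> real, the loop \<open>g\<close> with eigenlines
  \<open>\<complex>v\<close>, \<open>\<complex>w\<close> and eigenvalues \<open>f\<close>, \<open>1/f\<close> satisfies \<open>g N g\<inverse> = f\<^sup>2 N\<close>, hence
  \<open>g (U g\<inverse> U\<inverse>) = I + t (f\<^sup>2 - 1) N\<close>, a product of two simple loops. With \<open>\<mu> = \<alpha> - \<delta>\<close> and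
  \<open>y = 1 / (\<lambda> - \<alpha>)\<close> one has \<open>f\<^sup>2 - 1 = 2 \<delta> y + \<delta>\<^sup>2 y\<^sup>2\<close>, and the choices \<open>\<delta> = \<plusminus>1\<close> with suitable
  \<open>t\<close> combine to \<open>y\<close> or \<open>y\<^sup>2\<close>.
\<close>

section \<open>The form \<open>herm\<close> and its adjoint\<close>

lemma herm_add_right: "herm u (v + w) = herm u v + herm u w"
  by (simp add: herm_def algebra_simps sum.distrib)

lemma herm_scale_right: "herm u (c *s w) = c * herm u w"
  by (simp add: herm_def algebra_simps sum_distrib_left)

lemma herm_add_left: "herm (u + v) w = herm u w + herm v w"
  by (simp add: herm_def algebra_simps sum.distrib)

lemma herm_scale_left: "herm (c *s u) w = cnj c * herm u w"
  by (simp add: herm_def algebra_simps sum_distrib_left)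

lemma herm_diff_right: "herm u (v - w) = herm u v - herm u w"
  by (simp add: herm_def algebra_simps sum_subtractf)

lemma herm_minus_right: "herm u (- v) = - herm u v"
  by (simp add: herm_def sum_negf)

lemma cnj_herm: "cnj (herm u v) = herm v u"
  by (simp add: herm_def algebra_simps)

lemma herm_zero_left [simp]: "herm 0 w = 0"
  by (simp add: herm_def)

lemma herm_zero_right [simp]: "herm u 0 = 0"
  by (simp add: herm_def)

lemmas herm_simps = herm_add_right herm_scale_right herm_add_left herm_scale_left herm_diff_right

lemma sum_UNIV_Plus:
  fixes f :: "'a::finite + 'b::finite \<Rightarrow> 'c::comm_monoid_add"
  shows "sum f UNIV = (\<Sum>i\<in>UNIV. f (Inl i)) + (\<Sum>j\<in>UNIV. f (Inr j))"
  by (simp add: sum.Plus flip: UNIV_Plus_UNIV)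

lemma sig_mult_vec: "(sig *v x) $ i = (case i of Inl _ \<Rightarrow> - 1 | Inr _ \<Rightarrow> 1) * x $ i"
  by (simp add: matrix_vector_mult_def sig_def mult_delta_left)

text \<open>Twisting by \<open>sig\<close> turns the indefinite form into the standard one, whose
  adjoint is the conjugate transpose.\<close>

lemma herm_sig_sum: "herm u w = (\<Sum>i\<in>UNIV. cnj (u $ i) * (sig *v w) $ i)"
  by (simp add: herm_def sum_UNIV_Plus sig_mult_vec sum_negf)

lemma sig_mult_sig: "sig *v (sig *v x) = x"
  by (simp add: vec_eq_iff sig_mult_vec split: sum.split)

lemma herm_sig_sig: "herm (sig *v u) (sig *v w) = herm u w"
  by (simp add: herm_def sig_mult_vec)

lemma herm_adj_right: "herm u (adj A *v w) = herm (A *v u) w"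
proof -
  have "herm u (adj A *v w) = (\<Sum>i\<in>UNIV. cnj (u $ i) * (transpose (map_matrix cnj A) *v (sig *v w)) $ i)"
    by (simp add: herm_sig_sum adj_def sig_mult_sig flip: matrix_vector_mul_assoc)
  also have "\<dots> = (\<Sum>i\<in>UNIV. \<Sum>j\<in>UNIV. cnj (u $ i) * cnj (A $ j $ i) * (sig *v w) $ j)"
    by (simp add: matrix_vector_mult_def transpose_def map_matrix_def sum_distrib_left mult.assoc)
  also have "\<dots> = (\<Sum>j\<in>UNIV. \<Sum>i\<in>UNIV. cnj (u $ i) * cnj (A $ j $ i) * (sig *v w) $ j)"
    by (rule sum.swap)
  also have "\<dots> = (\<Sum>j\<in>UNIV. cnj ((A *v u) $ j) * (sig *v w) $ j)"
    by (simp add: matrix_vector_mult_def sum_distrib_right sum_distrib_left mult_ac)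
  finally show ?thesis by (simp add: herm_sig_sum)
qed

text \<open>Supplies a vector not orthogonal to \<open>v\<close> even when \<open>v\<close> is
  isotropic: the pairing is the squared Euclidean norm.\<close>

lemma herm_sig_pos:
  assumes "v \<noteq> 0"
  shows "\<exists>r::real. r > 0 \<and> herm v (sig *v v) = complex_of_real r"
proof -
  have "herm v (sig *v v) = complex_of_real (\<Sum>i\<in>UNIV. (cmod (v $ i))\<^sup>2)"
    by (simp add: herm_sig_sum sig_mult_sig complex_norm_square mult.commute del: of_real_power)
  moreover have "(\<Sum>i\<in>UNIV. (cmod (v $ i))\<^sup>2) > 0"
    using assms by (auto simp: vec_eq_iff intro!: sum_pos2)
  ultimately show ?thesis by blast
qed

section \<open>Projections and simple loops acting on vectors\<close>

lemma map_matrix_scale_mult_vec: "map_matrix ((*) c) A *v x = c *s (A *v x)"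
  by (simp add: vec_eq_iff matrix_vector_mult_def map_matrix_def sum_distrib_left mult.assoc)

lemma uminus_matrix_mult_vec: "(- A) *v x = - (A *v x)" for A :: "'a::ring_1 ^ 'n ^ 'm"
  by (simp add: vec_eq_iff matrix_vector_mult_def sum_negf)

lemma linear_functional_scale:
  fixes l :: "complex ^ ('p::finite + 'q::finite)"
  shows "Vector_Spaces.linear (*s) (*s) (\<lambda>x. (herm m x / c) *s l)"
  by unfold_locales (simp_all add: herm_simps vec.scale_left_distrib add_divide_distrib)

lemma complex_line_span:
  assumes "l \<noteq> 0"
  shows "complex_line (vec.span {l})"
  using assms by (simp add: complex_line_def vec.subspace_span vec.dim_eq_card_independent)

lemma factor_data_span:
  assumes "herm l l = 0" "herm m m = 0" "herm l m \<noteq> 0"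
  shows "factor_data (vec.span {l}) (vec.span {m}) (perp (vec.span {l}) \<inter> perp (vec.span {m}))"
proof -
  have "l \<noteq> 0" "m \<noteq> 0" using assms by auto
  then show ?thesis using assms
    by (auto simp: factor_data_def complex_line_span)
      (auto simp: isotropic_def lines_nonorthogonal_def vec.span_singleton herm_simps)
qed

lemma perp_span_singleton: "perp (vec.span {l}) = {x. herm l x = 0}"
  by (auto simp: perp_def vec.span_singleton herm_simps dest: spec[of _ 1] intro: exI[of _ 1])

text \<open>Pairing a decomposition of \<open>x\<close> with \<open>m\<close> or \<open>l\<close>
  leaves only its \<open>l\<close>- or \<open>m\<close>-component, since both lines are isotropic
  and \<open>W\<close> is orthogonal to them. So the components are unique and the
  \<open>THE\<close> in \<open>proj3\<close> is meaningful.\<close>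

lemma proj3_line:
  fixes l m :: "complex ^ ('p::finite + 'q::finite)"
  assumes "herm l l = 0" "herm m m = 0" "herm l m \<noteq> 0"
  defines "W \<equiv> perp (vec.span {l}) \<inter> perp (vec.span {m})"
  shows "proj3 (vec.span {l}) (vec.span {m}) W *v x = (herm m x / herm m l) *s l"
    and "proj3 W (vec.span {l}) (vec.span {m}) *v x =
      x - (herm m x / herm m l) *s l - (herm l x / herm l m) *s m"
proof -
  have ml: "herm m l \<noteq> 0" using assms(3) cnj_herm[of m l] by auto
  have W: "W = {x. herm l x = 0 \<and> herm m x = 0}" by (auto simp: W_def perp_span_singleton)
  have dec: "\<exists>b\<in>vec.span {m}. \<exists>c\<in>W. x = (herm m x / herm m l) *s l + b + c" for x
  proof (intro bexI)
    show "x - (herm m x / herm m l) *s l - (herm l x / herm l m) *s m \<in> W"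
      using ml assms(1-3) by (simp add: W herm_simps)
    show "(herm l x / herm l m) *s m \<in> vec.span {m}" by (auto simp: vec.span_singleton)
  qed simp
  have uni: "a = herm m x / herm m l \<and> b = herm l x / herm l m"
    if "x = a *s l + b *s m + c" "c \<in> W" for x a b c
    using that assms(1-3) ml by (simp add: W herm_simps)
  have "(THE a. a \<in> vec.span {l} \<and> (\<exists>b\<in>vec.span {m}. \<exists>c\<in>W. x = a + b + c)) =
      (herm m x / herm m l) *s l" for x
    using dec[of x] uni[of x] by (intro the_equality) (auto simp: vec.span_singleton)
  then show "proj3 (vec.span {l}) (vec.span {m}) W *v x = (herm m x / herm m l) *s l"
    by (simp add: proj3_def matrix_works[OF linear_functional_scale])
  let ?P = "\<lambda>x. x - (herm m x / herm m l) *s l - (herm l x / herm l m) *s m"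
  have "(THE a. a \<in> W \<and> (\<exists>b\<in>vec.span {l}. \<exists>c\<in>vec.span {m}. x = a + b + c)) = ?P x" for x
  proof (rule the_equality)
    have "?P x \<in> W" using ml assms(1-3) by (simp add: W herm_simps)
    moreover have "x = ?P x + (herm m x / herm m l) *s l + (herm l x / herm l m) *s m" by simp
    ultimately show "?P x \<in> W \<and> (\<exists>b\<in>vec.span {l}. \<exists>c\<in>vec.span {m}. x = ?P x + b + c)"
      unfolding vec.span_singleton by blast
    fix a assume "a \<in> W \<and> (\<exists>b\<in>vec.span {l}. \<exists>c\<in>vec.span {m}. x = a + b + c)"
    then obtain b c where "a \<in> W" and x: "x = a + b *s l + c *s m"
      by (auto simp: vec.span_singleton)
    then have "b = herm m x / herm m l \<and> c = herm l x / herm l m"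
      by (intro uni[of x b c a]) (simp_all add: add.commute add.left_commute)
    moreover have "a = x - b *s l - c *s m" using x by simp
    ultimately show "a = ?P x" by simp
  qed
  moreover have "Vector_Spaces.linear (*s) (*s) ?P"
    by (intro vec.linear_compose_sub linear_functional_scale vec.linear_ident)
  ultimately show "proj3 W (vec.span {l}) (vec.span {m}) *v x = ?P x"
    unfolding proj3_def using matrix_works[of ?P] by simp
qed

lemma simple_loop_mult_vec:
  fixes l m :: "complex ^ ('p::finite + 'q::finite)"
  assumes "herm l l = 0" "herm m m = 0" "herm l m \<noteq> 0"
  shows "simple_loop \<mu> \<nu> (vec.span {l}) (vec.span {m}) (perp (vec.span {l}) \<inter> perp (vec.span {m})) z *v x =
    x + (((z - \<mu>) / (z - \<nu>) - 1) * (herm m x / herm m l)) *s l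
      + (((z - cnj \<nu>) / (z - cnj \<mu>) - 1) * (herm l x / herm l m)) *s m"
proof -
  have "herm m l \<noteq> 0" using assms(3) cnj_herm[of m l] by auto
  \<comment> \<open>The projection onto the second line is the first formula with \<open>l\<close>
    and \<open>m\<close> exchanged.\<close>
  note p = proj3_line[OF assms] proj3_line(1)[OF assms(2,1) this, unfolded Int_commute[of "perp (vec.span {m})"]]
  have "c *s (a *s l) + d *s (b *s m) + (x - a *s l - b *s m) = x + ((c - 1) * a) *s l + ((d - 1) * b) *s m"
    for a b c d
    by (simp add: vec_eq_iff algebra_simps)
  then show ?thesis
    unfolding simple_loop_def matrix_vector_mult_add_rdistrib map_matrix_scale_mult_vec p .
qed

text \<open>With \<open>U x = x + (s / r) <v, x> v\<close>, the vector \<open>w + s *s v\<close> is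
  \<open>U w\<close>, so the inner factor, with \<alpha> and \<mu> exchanged, is the inverse of the
  outer one conjugated by \<open>U\<close>. Imaginary \<open>s\<close> keeps \<open>U w\<close>
  isotropic; real \<alpha> and \<mu> make the two eigenvalues reciprocal.\<close>

lemma simple_loop_pair:
  fixes v w :: "complex ^ ('p::finite + 'q::finite)" and r \<alpha> \<mu> :: real
  assumes "herm v v = 0" "herm w w = 0" "herm v w = of_real r" "r \<noteq> 0" "cnj s = - s"
    and "z \<noteq> of_real \<alpha>" "z \<noteq> of_real \<mu>"
  defines "F \<equiv> \<lambda>\<mu> \<nu> u. simple_loop \<mu> \<nu> (vec.span {v}) (vec.span {u}) (perp (vec.span {v}) \<inter> perp (vec.span {u})) z"
  shows "F \<mu> \<alpha> w *v (F \<alpha> \<mu> (w + s *s v) *v x) =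
    x + (s * (((z - \<mu>) / (z - \<alpha>))\<^sup>2 - 1) * (herm v x / r)) *s v"
proof -
  define f where "f = (z - \<mu>) / (z - \<alpha>)"
  have f: "f \<noteq> 0" "(z - \<alpha>) / (z - \<mu>) = 1 / f" using assms by (auto simp: f_def)
  have wv: "herm w v = of_real r" using cnj_herm[of v w] assms(3) by simp
  have "herm (w + s *s v) (w + s *s v) = 0" "herm v (w + s *s v) \<noteq> 0"
    using assms wv by (simp_all add: herm_simps)
  note A = simple_loop_mult_vec[OF assms(1) this]
  note B = simple_loop_mult_vec[OF assms(1,2)]
  \<comment> \<open>\<open>b\<close> and \<open>a\<close> are the coordinates of \<open>x\<close>
    along \<open>v\<close> and \<open>w\<close>; replacing \<open>w\<close> by
    \<open>w + s *s v\<close> changes \<open>b\<close> to \<open>b - s * a\<close>.\<close>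
  define a where "a = herm v x / r"
  define b where "b = herm w x / r"
  have ab: "herm v x = a * r" "herm w x = b * r" using assms(4) by (simp_all add: a_def b_def)
  have w': "herm v (w + s *s v) = r" "herm (w + s *s v) v = r"
    "herm (w + s *s v) x / r = b - s * a"
    using assms(1-5) wv by (simp_all add: herm_simps ab diff_divide_distrib)
  have A': "F \<alpha> \<mu> (w + s *s v) *v x =
      x + ((1/f - 1) * (b - s * a)) *s v + ((f - 1) * a) *s (w + s *s v)"
    unfolding F_def A w' complex_cnj_complex_of_real f(2) f_def[symmetric] a_def[symmetric] ..
  have B': "F \<mu> \<alpha> w *v y = y + ((f - 1) * (herm w y / r)) *s v + ((1/f - 1) * (herm v y / r)) *s w" for y
    using assms(3,4) unfolding F_def
    by (subst B) (simp_all only: wv complex_cnj_complex_of_real f(2) f_def[symmetric] of_real_eq_0_iff not_False_eq_True)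
  have hw: "herm w (F \<alpha> \<mu> (w + s *s v) *v x) = (b + (1/f - 1) * (b - s * a) + (f - 1) * a * s) * r"
    unfolding A' using assms(1-3) wv by (simp add: herm_simps ab algebra_simps)
  have hv: "herm v (F \<alpha> \<mu> (w + s *s v) *v x) = (a + (f - 1) * a) * r"
    unfolding A' using assms(1-3) wv by (simp add: herm_simps ab algebra_simps)
  \<comment> \<open>Total changes of the \<open>v\<close>- and \<open>w\<close>-coordinates; the
    second vanishes because \<open>w\<close> is scaled by \<open>f\<close> and then by
    \<open>1/f\<close>.\<close>
  have e: "(1/f - 1) * (b - s * a) + (f - 1) * a * s + (f - 1) * (b + (1/f - 1) * (b - s * a) + (f - 1) * a * s)
      = s * (f\<^sup>2 - 1) * a"
    "(f - 1) * a + (1/f - 1) * (a + (f - 1) * a) = 0"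
    using f(1) by (simp_all add: field_simps power2_eq_square)
  have comb: "x + c1 *s v + c2 *s (w + s *s v) + c3 *s v + c4 *s w
      = x + (c1 + c2 * s + c3) *s v + (c2 + c4) *s w" for c1 c2 c3 c4
    by (simp add: vec_eq_iff algebra_simps)
  have canc: "c * of_real r / of_real r = c" for c :: complex using assms(4) by simp
  have "F \<mu> \<alpha> w *v (F \<alpha> \<mu> (w + s *s v) *v x) = x + (s * (f\<^sup>2 - 1) * a) *s v"
    unfolding B' hw hv unfolding A' canc comb e by simp
  then show ?thesis by (simp add: f_def a_def)
qed

section \<open>Normal form of \<open>N\<close>\<close>

lemma rank_one_skew_nilpotent:
  fixes N :: "complex ^ ('p::finite + 'q::finite) ^ ('p + 'q)"
  assumes "N ** N = 0" "adj N = - N" "rank N = 1"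
  obtains v \<kappa> where "v \<noteq> 0" "herm v v = 0" "cnj \<kappa> = - \<kappa>" "\<And>x. N *v x = (\<kappa> * herm v x) *s v"
proof -
  have skew: "herm u (N *v w) = - herm (N *v u) w" for u w
    using herm_adj_right[of u N w] unfolding assms(2)
    by (simp add: uminus_matrix_mult_vec herm_minus_right minus_equation_iff eq_commute)
  have "vec.dim (rows N) = 1" using assms(3) by (simp add: row_rank_def_gen)
  then obtain B where B: "rows N \<subseteq> vec.span B" "card B = 1" by (metis vec.basis_exists)
  \<comment> \<open>All rows lie on one line, so \<open>N\<close> is an outer product and its range
    is a line.\<close>
  then obtain u where "B = {u}" by (meson card_1_singletonE)
  then have "\<exists>c. row i N = c *s u" for i using B(1) by (auto simp: rows_def vec.span_singleton)
  then obtain c where c: "row i N = c i *s u" for i by metis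
  have "N $ i $ j = c i * u $ j" for i j
    using arg_cong[OF c, of "\<lambda>y. y $ j"] by (simp add: row_def)
  then have range: "N *v x = (\<Sum>j\<in>UNIV. u $ j * x $ j) *s (\<chi> i. c i)" for x
    by (simp add: vec_eq_iff matrix_vector_mult_def sum_distrib_left mult_ac)
  have "N \<noteq> 0" using assms(3) by (auto simp: row_rank_def_gen rows_def row_def)
  then obtain x0 where x0: "N *v x0 \<noteq> 0" by (metis matrix_eq matrix_vector_mult_0)
  define v where "v = N *v x0"
  define e where "e x = (\<Sum>j\<in>UNIV. u $ j * x $ j)" for x
  have "e x0 \<noteq> 0" using x0 range[of x0] by (auto simp: e_def)
  define \<phi> where "\<phi> x = e x / e x0" for x
  have \<phi>: "N *v x = \<phi> x *s v" for x using \<open>e x0 \<noteq> 0\<close> by (simp add: \<phi>_def v_def range flip: e_def)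
  have v0: "v \<noteq> 0" using x0 v_def by simp
  then obtain r where r: "r > 0" "herm v (sig *v v) = complex_of_real r" using herm_sig_pos by blast
  have r': "herm (sig *v v) v = of_real r" using r(2) cnj_herm[of v "sig *v v"] by simp
  \<comment> \<open>Skewness against \<open>sig *v v\<close>, whose pairing with \<open>v\<close> is
    \<open>r > 0\<close>, forces \<phi> to be a multiple of \<open>herm v\<close>.\<close>
  define \<kappa> where "\<kappa> = - cnj (\<phi> (sig *v v)) / r"
  have "\<phi> x * r = - cnj (\<phi> (sig *v v)) * herm v x" for x
    using skew[of "sig *v v" x] by (simp add: \<phi> herm_simps r')
  then have "\<phi> x = \<kappa> * herm v x" for x using r(1) by (simp add: \<kappa>_def field_simps)
  then have N: "N *v x = (\<kappa> * herm v x) *s v" for x using \<phi> by simp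
  \<comment> \<open>\<open>N *v v\<close> is \<open>N\<close> applied twice to \<open>x0\<close>; as
    \<kappa> is nonzero, \<open>v\<close> must be isotropic.\<close>
  have "N *v v = 0" unfolding v_def matrix_vector_mul_assoc assms(1) by simp
  moreover have "\<kappa> \<noteq> 0" using N[of x0] x0 by auto
  ultimately have "herm v v = 0" using N[of v] v0 by simp
  moreover have "(cnj \<kappa> + \<kappa>) * (r * r) = 0"
    using skew[of "sig *v v" "sig *v v"] r(2) by (simp add: N herm_simps r' algebra_simps)
  then have "cnj \<kappa> = - \<kappa>" using r(1) by (simp add: add_eq_0_iff2)
  ultimately show thesis using that v0 N by blast
qed

(* Loops are rational functions of z (the loop parameter); because x / 0 = 0, their equality is asserted at every z
   that is neither the pole of the nilpotent loop nor a pole \<nu>, cnj \<mu> of one of the factors. *)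
theorem proposition5p4:
  fixes N :: "complex ^ ('p::finite + 'q::finite) ^ ('p + 'q)"
    and \<alpha> :: real and k :: nat
  assumes "0 < CARD('p)" and "CARD('p) \<le> CARD('q)"
    and "k \<in> {1, 2}"
    and "N ** N = 0" and "adj N = - N" and "rank N = 1"
  shows "\<exists>ds :: (complex \<times> complex \<times> (complex ^ ('p + 'q)) set \<times>
                  (complex ^ ('p + 'q)) set \<times> (complex ^ ('p + 'q)) set) list.
           (\<forall>(\<mu>, \<nu>, L, K, W) \<in> set ds. factor_data L K W) \<and>
           (\<forall>z. z \<noteq> complex_of_real \<alpha> \<longrightarrow>
                (\<forall>(\<mu>, \<nu>, L, K, W) \<in> set ds. z \<noteq> \<nu> \<and> z \<noteq> cnj \<mu>) \<longrightarrow>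
                nilpotent_loop \<alpha> k N z =
                  loop_prod (map (\<lambda>(\<mu>, \<nu>, L, K, W). simple_loop \<mu> \<nu> L K W) ds) z)"
proof -
  obtain v \<kappa> where v: "v \<noteq> 0" "herm v v = 0" and \<kappa>: "cnj \<kappa> = - \<kappa>"
    and N: "\<And>x. N *v x = (\<kappa> * herm v x) *s v"
    using rank_one_skew_nilpotent[OF assms(4-6)] by blast
  define w where "w = sig *v v"
  obtain r where r: "r > 0" "herm v w = complex_of_real r" using herm_sig_pos[OF v(1)] w_def by blast
  have wv: "herm w v = complex_of_real r" using r(2) cnj_herm[of v w] by simp
  have ww: "herm w w = 0" using v(2) by (simp add: w_def herm_sig_sig)
  \<comment> \<open>\<open>w + s t *s v\<close> is the image of \<open>w\<close> under
    \<open>I + t N\<close>.\<close>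
  define s where "s t = complex_of_real (t * r) * \<kappa>" for t
  have s: "cnj (s t) = - s t" for t by (simp add: s_def \<kappa>)
  define d where "d \<mu> \<nu> u = (complex_of_real \<mu>, complex_of_real \<nu>, vec.span {v}, vec.span {u},
    perp (vec.span {v}) \<inter> perp (vec.span {u}))" for \<mu> \<nu> u
  \<comment> \<open>The two pairs contribute \<open>2 * y + y^2\<close> and
    \<open>- 2 * y + y^2\<close>: a quarter of the difference is \<open>y\<close>, half the sum is
    \<open>y^2\<close>.\<close>
  define c1 c2 :: real where "c1 = (if k = 1 then 1/4 else 1/2)" and "c2 = (if k = 1 then -1/4 else 1/2)"
  define ds where "ds = [d (\<alpha> - 1) \<alpha> w, d \<alpha> (\<alpha> - 1) (w + s c1 *s v),
    d (\<alpha> + 1) \<alpha> w, d \<alpha> (\<alpha> + 1) (w + s c2 *s v)]"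
  have "herm (w + s t *s v) (w + s t *s v) = 0" "herm v (w + s t *s v) \<noteq> 0" for t
    using r v ww s by (simp_all add: herm_simps wv)
  then have "\<forall>(\<mu>, \<nu>, L, K, W) \<in> set ds. factor_data L K W"
    using factor_data_span[OF v(2)] ww r by (simp add: ds_def d_def)
  moreover have "nilpotent_loop \<alpha> k N z = loop_prod (map (\<lambda>(\<mu>, \<nu>, L, K, W). simple_loop \<mu> \<nu> L K W) ds) z"
    if z: "z \<noteq> complex_of_real \<alpha>" and poles: "\<forall>(\<mu>, \<nu>, L, K, W) \<in> set ds. z \<noteq> \<nu> \<and> z \<noteq> cnj \<mu>" for z
  proof (subst matrix_eq, rule allI)
    fix x
    have z': "z \<noteq> complex_of_real (\<alpha> - 1)" "z \<noteq> complex_of_real (\<alpha> + 1)"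
      using poles by (simp_all add: ds_def d_def)
    note pair = simple_loop_pair[OF v(2) ww r(2) less_imp_neq[OF r(1), symmetric] s z]
    define y where "y = 1 / (z - \<alpha>)"
    define X1 where "X1 = (z - complex_of_real (\<alpha> - 1)) / (z - \<alpha>)"
    define X2 where "X2 = (z - complex_of_real (\<alpha> + 1)) / (z - \<alpha>)"
    have X: "X1 = 1 + y" "X2 = 1 - y"
      using z by (simp_all add: X1_def X2_def y_def field_simps)
    have "loop_prod (map (\<lambda>(\<mu>, \<nu>, L, K, W). simple_loop \<mu> \<nu> L K W) ds) z *v x =
      x + (s c2 * (X2\<^sup>2 - 1) * (herm v x / r)) *s v +
      (s c1 * (X1\<^sup>2 - 1) * (herm v (x + (s c2 * (X2\<^sup>2 - 1) * (herm v x / r)) *s v) / r)) *s v"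
      \<comment> \<open>Read backwards, the pair identity turns each added multiple of
        \<open>v\<close> into two simple loops, the last two acting first.\<close>
      unfolding X1_def X2_def pair[OF z'(1), symmetric] pair[OF z'(2), symmetric]
      by (simp only: loop_prod_def ds_def d_def list.map foldr.simps o_apply case_prod_conv id_apply
          matrix_mul_rid matrix_vector_mul_assoc matrix_mul_assoc)
    \<comment> \<open>The cross term contains \<open>herm v v\<close> and vanishes, so the
      coefficients of \<open>N\<close> add.\<close>
    also have "\<dots> = x + ((c2 * (X2\<^sup>2 - 1) + c1 * (X1\<^sup>2 - 1)) * (\<kappa> * herm v x)) *s v"
      using r(1) v(2) by (simp add: herm_simps s_def vec_eq_iff algebra_simps)
    also have "c2 * (X2\<^sup>2 - 1) + c1 * (X1\<^sup>2 - 1) = y ^ k"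
      using assms(3) by (auto simp: X c1_def c2_def power2_eq_square algebra_simps)
    also have "x + (y ^ k * (\<kappa> * herm v x)) *s v = nilpotent_loop \<alpha> k N z *v x"
      by (simp add: nilpotent_loop_def matrix_vector_mult_add_rdistrib map_matrix_scale_mult_vec N y_def)
    finally show "nilpotent_loop \<alpha> k N z *v x =
      loop_prod (map (\<lambda>(\<mu>, \<nu>, L, K, W). simple_loop \<mu> \<nu> L K W) ds) z *v x" ..
  qed
  ultimately show ?thesis by (intro exI[of _ ds]) blast
qed

end
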